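(* Let $N,M$ be positive integers, let $\mathcal A,\mathcal M\in\mathbb C^{N\times N}$ with $\mathcal A$ Hermitian positive semi-definite and $\mathcal M$ Hermitian positive definite, let $\mathcal B\in\mathbb C^{N\times M}$ satisfy $\mathcal A\mathcal M^{-1}\mathcal B=0$, let $\mathcal U\in\mathbb C^{M\times M}$ be Hermitian positive definite, let $c>0$ be real, let $\mathcal F\in\mathbb C^N$ and let $0\neq\mathcal G\in\operatorname{Im}\mathcal B^*\subset\mathbb C^M$. Suppose $\dim\mathbb C_0\neq 0$, and let $\mathcal H\in\mathbb C^{N\times\dim\mathbb C_0}$ be a matrix whose columns form an $\mathcal M$-orthonormal basis of $\mathbb C_0$ (equivalently, of the eigenspace for the zero eigenvalue of $(\mathcal A+\mathcal B\mathcal U\mathcal B^* )u=\lambda\mathcal M u$). Then the constrained system $$(\mathcal A+c\mathcal M)u+\mathcal B p=\mathcal F,\qquad \mathcal B^* u=\mathcal G\qquad (u\in\mathbb C^N,\ p\in\mathbb C^M)$$ has a solution $(u,p)$ whose component $u$ is unique, and this $u$ is obtained as follows: there are unique $u_g,\tilde u\in\mathbb C^N$ with $$(\mathcal A+\mathcal B\mathcal U\mathcal B^*+\mathcal M\mathcal H\mathcal H^*\mathcal M)u_g=\mathcal B\mathcal U\mathcal G,\qquad (\mathcal A+\mathcal B\mathcal U\mathcal B^*+\mathcal M\mathcal H\mathcal H^*\mathcal M)\tilde u=\mathcal F,$$ and then $u$ is the unique solution in $\mathbb C^N$ of $$(\mathcal A+c\mathcal M)u=\mathcal F-\mathcal B\mathcal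 U\mathcal B^*\tilde u+c\mathcal M u_g.$$
   Context: $X^*$ denotes the conjugate transpose of a matrix $X$. $\mathbb C_0:=\operatorname{Ker}\mathcal A\cap\operatorname{Ker}(\mathcal B\mathcal U\mathcal B^* )\subset\mathbb C^N$. $\mathcal M$-orthonormal means orthonormal for the inner product $(v,w)\mapsto w^*\mathcal M v$, i.e. $\mathcal H^*\mathcal M\mathcal H=I$. *)

theory Defs
  imports "HOL-Analysis.Analysis"
begin

definition ctranspose :: "complex^'n^'m \<Rightarrow> complex^'m^'n"  (\<open>_\<^sup>\<dagger>\<close> [1000] 1000)
  where "X\<^sup>\<dagger> = (\<chi> i j. cnj (X $ j $ i))"

definition hermitian :: "complex^'n^'n \<Rightarrow> bool"
  where "hermitian X \<longleftrightarrow> X\<^sup>\<dagger> = X"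

text \<open>The form \<open>(v, w) \<mapsto> w\<^sup>* X v\<close>: linear in \<open>v\<close>, conjugate-linear in \<open>w\<close>.\<close>

definition form :: "complex^'n^'n \<Rightarrow> complex^'n \<Rightarrow> complex^'n \<Rightarrow> complex"
  where "form X v w = (\<Sum>i\<in>UNIV. cnj (w $ i) * (X *v v) $ i)"

text \<open>For Hermitian \<open>X\<close> the number \<open>form X v v\<close> is real, so taking \<open>Re\<close> loses nothing.\<close>

definition pos_semidef :: "complex^'n^'n \<Rightarrow> bool"
  where "pos_semidef X \<longleftrightarrow> hermitian X \<and> (\<forall>v. 0 \<le> Re (form X v v))"

definition pos_def :: "complex^'n^'n \<Rightarrow> bool"
  where "pos_def X \<longleftrightarrow> hermitian X \<and> (\<forall>v. v \<noteq> 0 \<longrightarrow> 0 < Re (form X v v))"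

definition Ker :: "complex^'n^'m \<Rightarrow> (complex^'n) set"
  where "Ker X = {v. X *v v = 0}"

definition Im_mat :: "complex^'n^'m \<Rightarrow> (complex^'m) set"
  where "Im_mat X = range (\<lambda>v. X *v v)"

definition C0 :: "complex^'n^'n \<Rightarrow> complex^'m^'n \<Rightarrow> complex^'m^'m \<Rightarrow> (complex^'n) set"
  where "C0 A B U = Ker A \<inter> Ker (B ** U ** B\<^sup>\<dagger>)"

text \<open>Eigenspace of the generalized problem \<open>K u = \<lambda> M u\<close> (including the zero vector).\<close>

definition gen_eigenspace :: "complex^'n^'n \<Rightarrow> complex^'n^'n \<Rightarrow> complex \<Rightarrow> (complex^'n) set"
  where "gen_eigenspace K M l = {u. K *v u = l *s (M *v u)}"

text \<open>\<open>columns H\<close> is a set, so distinctness of the columns is required separately;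
  \<open>vec.independent\<close> and \<open>vec.span\<close> are over the scalar field \<open>complex\<close>.\<close>

definition orthonormal_basis_columns ::
    "complex^'n^'n \<Rightarrow> complex^'k^'n \<Rightarrow> (complex^'n) set \<Rightarrow> bool"
  where "orthonormal_basis_columns M H S \<longleftrightarrow>
    inj (\<lambda>j. column j H) \<and> vec.independent (columns H) \<and> vec.span (columns H) = S \<and>
    H\<^sup>\<dagger> ** M ** H = mat 1"

text \<open>The system \<open>(A + c M) u + B p = F\<close>, \<open>B\<^sup>* u = G\<close>.\<close>

definition constrained_system ::
    "complex^'n^'n \<Rightarrow> complex^'n^'n \<Rightarrow> complex^'m^'n \<Rightarrow> real \<Rightarrow> complex^'n \<Rightarrow> complex^'m
      \<Rightarrow> complex^'n \<Rightarrow> complex^'m \<Rightarrow> bool"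
  where "constrained_system A M B c F G u p \<longleftrightarrow>
    (A + c *\<^sub>R M) *v u + B *v p = F \<and> B\<^sup>\<dagger> *v u = G"

end

theory Submission
  imports Defs
begin

text \<open>Everything is phrased with the real inner product \<open>\<bullet>\<close> of \<open>complex^'n\<close>, which is the real
  part of the Hermitian one.  Put \<open>K = A + B U B\<^sup>\<dagger>\<close> and \<open>T = K + M H H\<^sup>\<dagger> M\<close>.  Both summands of \<open>K\<close> are
  positive semidefinite, so \<open>Ker K = Ker A \<inter> Ker B\<^sup>\<dagger>\<close>, and \<open>T\<close> is injective.
  Multiplying by \<open>H\<^sup>\<dagger>\<close> and by \<open>B\<^sup>\<dagger> M\<^sup>-\<^sup>1\<close> (which kills \<open>A\<close>) one finds that
  \<open>u\<^sub>g\<close> satisfies \<open>B\<^sup>\<dagger> u\<^sub>g = G\<close>, \<open>A u\<^sub>g = 0\<close> and \<open>M u\<^sub>g \<in> Im B\<close>. Hence the solution of the last equation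
  solves the constrained system, whose \<open>u\<close>-component is unique because \<open>A + c M\<close> is
  positive definite.\<close>

section \<open>Matrix-vector algebra and adjoints for the real inner product\<close>

lemma matrix_vector_mult_scaleR_right:
  fixes X :: "'a::real_algebra_1^'n^'m"
  shows "X *v (r *\<^sub>R v) = r *\<^sub>R (X *v v)"
  by (simp add: vec_eq_iff matrix_vector_mult_def scaleR_sum_right)

lemma matrix_vector_mult_scaleR_left:
  fixes X :: "'a::real_algebra_1^'n^'m"
  shows "(r *\<^sub>R X) *v v = r *\<^sub>R (X *v v)"
  by (simp add: vec_eq_iff matrix_vector_mult_def scaleR_sum_right)

lemma matrix_vector_mult_axis:
  fixes X :: "'a::semiring_1^'n^'m"
  shows "X *v axis k 1 = column k X"
  by (simp add: vec_eq_iff matrix_vector_mult_def column_def axis_def if_distrib cong: if_cong)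

lemma matrix_inv:
  fixes X :: "'a::semiring_1^'n^'m"
  assumes "invertible X"
  shows matrix_inv_right: "X ** matrix_inv X = mat 1" and matrix_inv_left: "matrix_inv X ** X = mat 1"
  using someI_ex[OF assms[unfolded invertible_def]] by (simp_all add: matrix_inv_def)

lemma Re_form: "Re (form X v w) = (X *v v) \<bullet> w"
  by (simp add: form_def inner_vec_def inner_complex_def algebra_simps)

text \<open>On the complex plane, multiplication by a scalar has multiplication by its conjugate as
  real adjoint; exchanging the two sums extends this to matrices. So the conjugate transpose is also
  the adjoint for the real inner product.\<close>

lemma inner_ctranspose_right:
  fixes X :: "complex^'n^'m"
  shows "(X *v v) \<bullet> w = v \<bullet> (X\<^sup>\<dagger> *v w)"
proof -
  have "(X *v v) \<bullet> w = (\<Sum>i\<in>UNIV. \<Sum>j\<in>UNIV. (X$i$j * v$j) \<bullet> w$i)"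
    by (simp add: inner_vec_def matrix_vector_mult_def inner_sum_left)
  also have "\<dots> = (\<Sum>j\<in>UNIV. \<Sum>i\<in>UNIV. v$j \<bullet> (cnj (X$i$j) * w$i))"
    by (subst sum.swap) (intro sum.cong refl, simp add: inner_complex_def algebra_simps)
  also have "\<dots> = v \<bullet> (X\<^sup>\<dagger> *v w)"
    by (simp add: inner_vec_def matrix_vector_mult_def inner_sum_right ctranspose_def)
  finally show ?thesis .
qed

lemma ctranspose_ctranspose [simp]: "X\<^sup>\<dagger>\<^sup>\<dagger> = X"
  by (simp add: ctranspose_def vec_eq_iff)

lemma inner_ctranspose_left:
  fixes X :: "complex^'n^'m"
  shows "(X\<^sup>\<dagger> *v v) \<bullet> w = v \<bullet> (X *v w)"
  using inner_ctranspose_right[of "X\<^sup>\<dagger>"] by simp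

lemma hermitian_inner:
  assumes "hermitian X"
  shows "(X *v v) \<bullet> w = v \<bullet> (X *v w)"
  using assms inner_ctranspose_right[of X] by (simp add: hermitian_def)

section \<open>Semidefinite and definite matrices\<close>

lemma pos_semidef_hermitian: "pos_semidef X \<Longrightarrow> hermitian X"
  by (simp add: pos_semidef_def)

lemma pos_def_hermitian: "pos_def X \<Longrightarrow> hermitian X"
  by (simp add: pos_def_def)

lemma pos_semidef_inner_nonneg: "pos_semidef X \<Longrightarrow> 0 \<le> (X *v v) \<bullet> v"
  by (simp add: pos_semidef_def Re_form)

lemma pos_def_inner_nonneg: "pos_def X \<Longrightarrow> 0 \<le> (X *v v) \<bullet> v"
  by (cases "v = 0") (auto simp: pos_def_def Re_form intro: less_imp_le)

lemma pos_def_inner_eq_0: "pos_def X \<Longrightarrow> (X *v v) \<bullet> v = 0 \<Longrightarrow> v = 0"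
  by (force simp: pos_def_def Re_form)

text \<open>Otherwise moving from \<open>v\<close> a little in the direction
  \<open>- (X *v v)\<close> would make the quadratic form negative: its first-order change is
  strictly negative, and the second-order term is dominated for small steps.\<close>

lemma pos_semidef_inner_eq_0:
  fixes X :: "complex^'n^'n"
  assumes X: "pos_semidef X" and v: "(X *v v) \<bullet> v = 0"
  shows "X *v v = 0"
proof (rule ccontr)
  define w b where "w = X *v v" and "b = (X *v w) \<bullet> w"
  assume "X *v v \<noteq> 0"
  then have w0: "w \<bullet> w > 0" by (simp add: w_def)
  have b0: "b \<ge> 0" using pos_semidef_inner_nonneg[OF X] by (simp add: b_def)
  have quad: "0 \<le> t * t * b - 2 * t * (w \<bullet> w)" for t :: real
  proof -
    have "(X *v w) \<bullet> v = w \<bullet> w"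
      using hermitian_inner[OF pos_semidef_hermitian[OF X]] by (simp add: w_def)
    moreover have "0 \<le> (X *v (v - t *\<^sub>R w)) \<bullet> (v - t *\<^sub>R w)"
      by (rule pos_semidef_inner_nonneg[OF X])
    ultimately show ?thesis
      using v by (simp add: inner_diff_left inner_diff_right b_def w_def
          matrix_vector_mult_scaleR_right algebra_simps)
  qed
  \<comment> \<open>The form at \<open>v - t *\<^sub>R w\<close> is negative for positive
    \<open>t\<close> with \<open>t * b < 2 * (w \<bullet> w)\<close>; dividing by
    \<open>b + 1\<close> instead of \<open>b\<close> also covers \<open>b = 0\<close>.\<close>
  define t where "t = (w \<bullet> w) / (b + 1)"
  have "t > 0" using w0 b0 by (simp add: t_def)
  moreover have "t * b < 2 * (w \<bullet> w)"
    using w0 b0 by (simp add: t_def divide_simps algebra_simps add_nonneg_pos)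
  ultimately have "t * (t * b) < t * (2 * (w \<bullet> w))" by simp
  then show False using quad[of t] by (simp add: algebra_simps)
qed

lemma injective_imp_invertible:
  fixes X :: "complex^'n^'n"
  assumes "\<And>v. X *v v = 0 \<Longrightarrow> v = 0"
  shows "invertible X"
  using assms by (metis matrix_left_invertible_ker invertible_left_inverse)

lemma invertible_ex1:
  fixes X :: "'a::field^'n^'n"
  assumes "invertible X"
  shows "\<exists>!v. X *v v = w"
proof (rule ex1I)
  show "X *v (matrix_inv X *v w) = w"
    using assms by (simp add: matrix_vector_mul_assoc matrix_inv_right)
  show "v = matrix_inv X *v w" if "X *v v = w" for v
    using assms that by (auto simp: matrix_vector_mul_assoc matrix_inv_left)
qed

lemma pos_def_invertible: "pos_def X \<Longrightarrow> invertible X"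
  by (rule injective_imp_invertible) (simp add: pos_def_inner_eq_0)

text \<open>Assuming only that the quadratic form vanishes, rather than the image of
  \<open>v\<close>, lets the lemma serve both invertibility and the uniqueness of \<open>u\<close>,
  where the image is merely known to be orthogonal to \<open>v\<close>.\<close>

lemma pos_semidef_plus_pos_def_inner_eq_0:
  assumes A: "pos_semidef A" and M: "pos_def M" and "c > 0"
    and v: "((A + c *\<^sub>R M) *v v) \<bullet> v = 0"
  shows "v = 0"
proof -
  have "(A *v v) \<bullet> v + c * ((M *v v) \<bullet> v) = 0"
    using v by (simp add: matrix_vector_mult_add_rdistrib inner_add_left matrix_vector_mult_scaleR_left)
  then have "(M *v v) \<bullet> v = 0"
    using \<open>c > 0\<close> pos_semidef_inner_nonneg[OF A, of v] pos_def_inner_nonneg[OF M, of v]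
    by (smt (verit) mult_pos_pos)
  then show ?thesis by (rule pos_def_inner_eq_0[OF M])
qed

lemma pos_semidef_plus_pos_def_invertible:
  assumes "pos_semidef A" "pos_def M" "c > 0"
  shows "invertible (A + c *\<^sub>R M)"
  by (rule injective_imp_invertible) (simp add: pos_semidef_plus_pos_def_inner_eq_0[OF assms])

lemma span_columns_eq_range:
  fixes X :: "'a::field^'n^'m"
  shows "vec.span (columns X) = range (\<lambda>a. X *v a)"
proof
  show "vec.span (columns X) \<subseteq> range (\<lambda>a. X *v a)"
  proof (rule vec.span_minimal)
    show "columns X \<subseteq> range (\<lambda>a. X *v a)"
      by (auto simp: columns_def simp flip: matrix_vector_mult_axis)
    show "vec.subspace (range (\<lambda>a. X *v a))"
      by (intro vec.subspace_image matrix_vector_mul_linear_gen vec.subspace_UNIV)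
  qed
  show "range (\<lambda>a. X *v a) \<subseteq> vec.span (columns X)"
    by (auto simp: matrix_vector_mult_in_columnspace_gen)
qed

lemma inner_BUB:
  fixes B :: "complex^'m^'n"
  shows "((B ** U ** B\<^sup>\<dagger>) *v v) \<bullet> v = (U *v (B\<^sup>\<dagger> *v v)) \<bullet> (B\<^sup>\<dagger> *v v)"
  by (simp add: inner_ctranspose_right flip: matrix_vector_mul_assoc)

text \<open>The quadratic form of \<open>B ** U ** B\<^sup>\<dagger>\<close> at \<open>v\<close> is
  that of \<open>U\<close> at \<open>B\<^sup>\<dagger> *v v\<close>, so definiteness of
  \<open>U\<close> applies.\<close>

lemma Ker_BUB:
  fixes B :: "complex^'m^'n"
  assumes "pos_def U"
  shows "Ker (B ** U ** B\<^sup>\<dagger>) = Ker (B\<^sup>\<dagger>)"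
proof -
  have "B\<^sup>\<dagger> *v v = 0" if "(B ** U ** B\<^sup>\<dagger>) *v v = 0" for v
    using that inner_BUB[of B U v] pos_def_inner_eq_0[OF assms] by simp
  then show ?thesis
    by (auto simp: Ker_def simp flip: matrix_vector_mul_assoc)
qed

section \<open>The null space \<open>C0\<close> and the invertibility of \<open>T\<close>\<close>

locale constrained_problem =
  fixes A M :: "complex^'n^'n" and B :: "complex^'m^'n" and U :: "complex^'m^'m"
    and H :: "complex^'k^'n"
  assumes A: "pos_semidef A" and M: "pos_def M" and AMB: "A ** matrix_inv M ** B = 0"
    and U: "pos_def U" and H: "orthonormal_basis_columns M H (C0 A B U)"
begin

abbreviation "T \<equiv> A + B ** U ** B\<^sup>\<dagger> + M ** H ** H\<^sup>\<dagger> ** M"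

lemma T_mult: "T *v v = A *v v + B *v (U *v (B\<^sup>\<dagger> *v v)) + M *v (H *v (H\<^sup>\<dagger> *v (M *v v)))"
  by (simp add: matrix_vector_mult_add_rdistrib flip: matrix_vector_mul_assoc)

lemma C0_eq: "C0 A B U = {v. A *v v = 0 \<and> B\<^sup>\<dagger> *v v = 0}"
  unfolding C0_def Ker_BUB[OF U] by (auto simp: Ker_def)

lemma C0_if_inner_eq_0:
  assumes "(A *v v + (B ** U ** B\<^sup>\<dagger>) *v v) \<bullet> v = 0"
  shows "v \<in> C0 A B U"
proof -
  have "(A *v v) \<bullet> v \<ge> 0" by (rule pos_semidef_inner_nonneg[OF A])
  moreover have "((B ** U ** B\<^sup>\<dagger>) *v v) \<bullet> v \<ge> 0"
    unfolding inner_BUB by (rule pos_def_inner_nonneg[OF U])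
  ultimately have "(A *v v) \<bullet> v = 0" "((B ** U ** B\<^sup>\<dagger>) *v v) \<bullet> v = 0"
    using assms unfolding inner_add_left by linarith+
  then have "A *v v = 0" "B\<^sup>\<dagger> *v v = 0"
    using pos_semidef_inner_eq_0[OF A] pos_def_inner_eq_0[OF U] unfolding inner_BUB by auto
  then show ?thesis by (simp add: C0_eq)
qed

lemma C0_eq_gen_eigenspace: "C0 A B U = gen_eigenspace (A + B ** U ** B\<^sup>\<dagger>) M 0"
proof (rule set_eqI, rule iffI)
  fix v assume "v \<in> gen_eigenspace (A + B ** U ** B\<^sup>\<dagger>) M 0"
  then have "(A *v v + (B ** U ** B\<^sup>\<dagger>) *v v) \<bullet> v = 0"
    by (simp add: gen_eigenspace_def matrix_vector_mult_add_rdistrib)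
  then show "v \<in> C0 A B U" by (rule C0_if_inner_eq_0)
qed (simp add: gen_eigenspace_def matrix_vector_mult_add_rdistrib C0_def Ker_def)

lemma C0_eq_range: "C0 A B U = range (\<lambda>a. H *v a)"
  using H by (simp add: orthonormal_basis_columns_def span_columns_eq_range)

lemma A_H: "A *v (H *v a) = 0" and B_H: "B\<^sup>\<dagger> *v (H *v a) = 0"
  using C0_eq C0_eq_range by auto

lemma H_M_H: "H\<^sup>\<dagger> *v (M *v (H *v a)) = a"
  using H by (simp add: orthonormal_basis_columns_def matrix_vector_mul_assoc matrix_mul_assoc)

text \<open>This is the adjoint of \<open>A_H\<close>, as \<open>A\<close> is Hermitian; a vector
  orthogonal to every \<open>y\<close> is orthogonal to itself, hence zero.\<close>

lemma H_A: "H\<^sup>\<dagger> *v (A *v x) = 0"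
proof -
  have "(H\<^sup>\<dagger> *v (A *v x)) \<bullet> y = 0" for y
    by (simp add: inner_ctranspose_left hermitian_inner[OF pos_semidef_hermitian[OF A]] A_H)
  then show ?thesis by (metis inner_eq_zero_iff)
qed

lemma H_B: "H\<^sup>\<dagger> *v (B *v x) = 0"
proof -
  have "(H\<^sup>\<dagger> *v (B *v x)) \<bullet> y = 0" for y
    by (simp add: inner_ctranspose_left inner_ctranspose_right B_H)
  then show ?thesis by (metis inner_eq_zero_iff)
qed

lemma H_T: "H\<^sup>\<dagger> *v (T *v x) = H\<^sup>\<dagger> *v (M *v x)"
  by (simp add: T_mult matrix_vector_right_distrib H_A H_B H_M_H)

lemma T_invertible: "invertible T"
proof (rule injective_imp_invertible)
  fix v assume T0: "T *v v = 0"
  let ?h = "H\<^sup>\<dagger> *v (M *v v)"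
  \<comment> \<open>Once \<open>?h\<close> vanishes, the rank correction drops out of
    \<open>T *v v\<close>, which puts \<open>v\<close> in the range of \<open>H\<close>; there
    \<open>?h\<close> is exactly the coordinate vector of \<open>v\<close>.\<close>
  have "?h = 0" using H_T[of v] T0 by simp
  moreover from this have "(A *v v + (B ** U ** B\<^sup>\<dagger>) *v v) \<bullet> v = 0"
    using T0 by (simp add: T_mult matrix_vector_mul_assoc matrix_mul_assoc)
  then have "v \<in> C0 A B U" by (rule C0_if_inner_eq_0)
  then obtain a where "v = H *v a" using C0_eq_range by auto
  ultimately show "v = 0" using H_M_H[of a] by simp
qed

section \<open>Orthogonality of the images of \<open>A\<close> and \<open>B\<close> with respect to
  \<open>M'\<close>\<close>

abbreviation "M' \<equiv> matrix_inv M"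

lemma M_M': "M *v (M' *v x) = x" and M'_M: "M' *v (M *v x) = x"
  using pos_def_invertible[OF M]
  by (simp_all add: matrix_vector_mul_assoc matrix_inv_left matrix_inv_right)

lemma M'_inner: "(M' *v x) \<bullet> y = x \<bullet> (M' *v y)"
  using hermitian_inner[OF pos_def_hermitian[OF M], of "M' *v x" "M' *v y"] by (simp add: M_M')

text \<open>The inverse inherits definiteness: with \<open>y = M' *v x\<close> the form equals
  \<open>y \<bullet> (M *v y)\<close>.\<close>

lemma M'_inner_eq_0: "(M' *v x) \<bullet> x = 0 \<Longrightarrow> x = 0"
  using pos_def_inner_eq_0[OF M, of "M' *v x"] M_M'[of x]
  by (metis inner_commute matrix_vector_mult_0_right)

lemma A_M'_B: "A *v (M' *v (B *v x)) = 0"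
  using AMB by (simp add: matrix_vector_mul_assoc matrix_mul_assoc)

text \<open>The adjoint of the hypothesis \<open>AMB\<close>, since \<open>A\<close> and
  \<open>M'\<close> are self-adjoint.\<close>

lemma B_M'_A: "B\<^sup>\<dagger> *v (M' *v (A *v x)) = 0"
proof -
  have "(B\<^sup>\<dagger> *v (M' *v (A *v x))) \<bullet> y = 0" for y
    by (simp add: inner_ctranspose_left hermitian_inner[OF pos_semidef_hermitian[OF A]]
        M'_inner A_M'_B)
  then show ?thesis by (metis inner_eq_zero_iff)
qed

lemma B_M'_B_eq_0: "B\<^sup>\<dagger> *v (M' *v (B *v x)) = 0 \<Longrightarrow> B *v x = 0"
  by (rule M'_inner_eq_0) (simp add: inner_ctranspose_left inner_commute inner_ctranspose_right)

lemma A_M'_A_eq_0: "A *v (M' *v (A *v x)) = 0 \<Longrightarrow> A *v x = 0"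
  by (rule M'_inner_eq_0)
    (metis hermitian_inner[OF pos_semidef_hermitian[OF A]] inner_zero_left)

section \<open>The vector \<open>ug\<close> and the passage from the formula to the constrained
  system\<close>

context
  fixes G ug
  assumes G: "G \<in> Im_mat (B\<^sup>\<dagger>)" and ug: "T *v ug = (B ** U) *v G"
begin

lemma H_ug: "H\<^sup>\<dagger> *v (M *v ug) = 0"
  using H_T[of ug] by (simp add: ug H_B flip: matrix_vector_mul_assoc)

lemma K_ug: "A *v ug + B *v (U *v (B\<^sup>\<dagger> *v ug)) = B *v (U *v G)"
  using ug by (simp only: T_mult H_ug) (simp flip: matrix_vector_mul_assoc)

lemma B_ug: "B\<^sup>\<dagger> *v ug = G"
proof -
  obtain w where w: "G = B\<^sup>\<dagger> *v w" using G by (auto simp: Im_mat_def)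
  let ?x = "U *v (B\<^sup>\<dagger> *v (ug - w))"
  \<comment> \<open>\<open>B *v ?x\<close> lies in the images of both \<open>A\<close> and
    \<open>B\<close>. These are \<open>M'\<close>-orthogonal, so it must vanish.\<close>
  have "B *v ?x = - (A *v ug)"
    using K_ug by (simp add: w matrix_vector_mult_diff_distrib algebra_simps eq_neg_iff_add_eq_0)
  then have "B\<^sup>\<dagger> *v (M' *v (B *v ?x)) = - (B\<^sup>\<dagger> *v (M' *v (A *v ug)))"
    by (simp add: vec.neg)
  then have "B *v ?x = 0" by (intro B_M'_B_eq_0) (simp add: B_M'_A)
  then have "ug - w \<in> Ker (B ** U ** B\<^sup>\<dagger>)" by (simp add: Ker_def flip: matrix_vector_mul_assoc)
  then have "ug - w \<in> Ker (B\<^sup>\<dagger>)" by (simp only: Ker_BUB[OF U])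
  then show ?thesis by (simp add: Ker_def w matrix_vector_mult_diff_distrib)
qed

lemma A_ug: "A *v ug = 0"
  using K_ug by (simp add: B_ug)

lemma M_ug: "\<exists>y. M *v ug = B *v y"
proof -
  \<comment> \<open>Expanding \<open>M *v ug\<close> through \<open>T\<close> splits it into an
    \<open>A\<close>-part and a \<open>B\<close>-part, because its \<open>H\<close>-part is zero.
    Applying \<open>A M'\<close> then isolates the \<open>A\<close>-part and shows that it
    vanishes.\<close>
  obtain z where z: "T *v z = M *v ug" using invertible_ex1[OF T_invertible] by blast
  have "H\<^sup>\<dagger> *v (M *v z) = 0" using H_T[of z] by (simp only: z H_ug)
  then have Mug: "M *v ug = A *v z + B *v (U *v (B\<^sup>\<dagger> *v z))"
    using z by (simp add: T_mult)
  have "A *v (M' *v (M *v ug)) = 0" by (simp add: M'_M A_ug)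
  then have "A *v (M' *v (A *v z)) = 0"
    unfolding Mug by (simp add: matrix_vector_right_distrib A_M'_B)
  then show ?thesis using Mug A_M'_A_eq_0[of z] by auto
qed

lemma constrained_system_if_formula:
  assumes ut: "T *v ut = F" and "c > 0"
    and v: "(A + c *\<^sub>R M) *v v = F - (B ** U ** B\<^sup>\<dagger>) *v ut + c *\<^sub>R (M *v ug)"
  shows "\<exists>p. constrained_system A M B c F G v p"
proof -
  let ?h = "H *v (H\<^sup>\<dagger> *v (M *v ut))"
  \<comment> \<open>Writing \<open>F\<close> as \<open>T *v ut\<close> cancels the term
    \<open>B U B\<^sup>\<dagger> ut\<close>. Of what remains on the right,
    \<open>B\<^sup>\<dagger> M'\<close> keeps only the contribution of \<open>ug\<close>.\<close>
  have "A *v v + c *\<^sub>R (M *v v) = A *v ut + M *v ?h + c *\<^sub>R (M *v ug)"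
    using v by (simp add: ut[symmetric] T_mult matrix_vector_mult_add_rdistrib
        matrix_vector_mult_scaleR_left flip: matrix_vector_mul_assoc)
  then have "B\<^sup>\<dagger> *v (M' *v (A *v v + c *\<^sub>R (M *v v)))
      = B\<^sup>\<dagger> *v (M' *v (A *v ut + M *v ?h + c *\<^sub>R (M *v ug)))" by simp
  then have "c *\<^sub>R (B\<^sup>\<dagger> *v v) = c *\<^sub>R G"
    by (simp add: matrix_vector_right_distrib matrix_vector_mult_scaleR_right B_M'_A M'_M B_H B_ug)
  then have Bv: "B\<^sup>\<dagger> *v v = G" using \<open>c > 0\<close> by simp
  obtain y where y: "M *v ug = B *v y" using M_ug by blast
  \<comment> \<open>The multiplier collects the two terms beside \<open>F\<close> in the formula:
    the first is visibly in the image of \<open>B\<close>, the second is so by the choice of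
    \<open>y\<close>.\<close>
  have "(A + c *\<^sub>R M) *v v + B *v (U *v (B\<^sup>\<dagger> *v ut) - c *\<^sub>R y) = F"
    by (simp add: v y matrix_vector_mult_diff_distrib matrix_vector_mult_scaleR_right
        flip: matrix_vector_mul_assoc)
  with Bv show ?thesis unfolding constrained_system_def by blast
qed

end

text \<open>The difference of two solutions lies in the kernel of \<open>B\<^sup>\<dagger>\<close>,
  hence is orthogonal to \<open>B *v (q - p)\<close>. The multipliers themselves may differ by an
  element of the kernel of \<open>B\<close>.\<close>

lemma constrained_system_unique:
  assumes "c > 0" "constrained_system A M B c F G u p" "constrained_system A M B c F G v q"
  shows "u = v"
proof -
  let ?P = "A + c *\<^sub>R M" and ?w = "u - v"
  have "?P *v ?w = B *v (q - p)" and Bw: "B\<^sup>\<dagger> *v ?w = 0"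
    using assms(2,3)
    by (auto simp: constrained_system_def matrix_vector_mult_diff_distrib algebra_simps)
  then have "(?P *v ?w) \<bullet> ?w = 0" by (simp add: inner_ctranspose_right Bw)
  then have "?w = 0" by (rule pos_semidef_plus_pos_def_inner_eq_0[OF A M \<open>c > 0\<close>])
  then show ?thesis by simp
qed

end

theorem mainTheorem9:
  fixes A M :: "complex^'n^'n" and B :: "complex^'m^'n" and U :: "complex^'m^'m"
    and c :: real and F :: "complex^'n" and G :: "complex^'m" and H :: "complex^'k^'n"
  assumes "pos_semidef A" and "pos_def M"
    and "A ** matrix_inv M ** B = 0"
    and "pos_def U"
    and "c > 0"
    and "G \<noteq> 0" and "G \<in> Im_mat (B\<^sup>\<dagger>)"
    and "vec.dim (C0 A B U) \<noteq> 0"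
    and "CARD('k) = vec.dim (C0 A B U)"
    and "orthonormal_basis_columns M H (C0 A B U)"
  shows "C0 A B U = gen_eigenspace (A + B ** U ** B\<^sup>\<dagger>) M 0 \<and>
    (\<exists>!u. \<exists>p. constrained_system A M B c F G u p) \<and>
    (\<exists>!ug. (A + B ** U ** B\<^sup>\<dagger> + M ** H ** H\<^sup>\<dagger> ** M) *v ug = (B ** U) *v G) \<and>
    (\<exists>!ut. (A + B ** U ** B\<^sup>\<dagger> + M ** H ** H\<^sup>\<dagger> ** M) *v ut = F) \<and>
    (\<forall>u p ug ut.
      constrained_system A M B c F G u p \<longrightarrow>
      (A + B ** U ** B\<^sup>\<dagger> + M ** H ** H\<^sup>\<dagger> ** M) *v ug = (B ** U) *v G \<longrightarrow>
      (A + B ** U ** B\<^sup>\<dagger> + M ** H ** H\<^sup>\<dagger> ** M) *v ut = F \<longrightarrow>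
      (\<forall>v. (A + c *\<^sub>R M) *v v = F - (B ** U ** B\<^sup>\<dagger>) *v ut + c *\<^sub>R (M *v ug) \<longleftrightarrow> v = u))"
proof -
  interpret constrained_problem A M B U H
    using assms by unfold_locales
  let ?S = "\<lambda>u. \<exists>p. constrained_system A M B c F G u p"
  let ?E = "\<lambda>ug ut v.
    (A + c *\<^sub>R M) *v v = F - (B ** U ** B\<^sup>\<dagger>) *v ut + c *\<^sub>R (M *v ug)"
  have ES: "?S v" if "T *v ug = (B ** U) *v G" "T *v ut = F" "?E ug ut v" for ug ut v
    using constrained_system_if_formula that \<open>G \<in> Im_mat (B\<^sup>\<dagger>)\<close> \<open>c > 0\<close> by blast
  have E: "\<exists>v. ?E ug ut v" for ug ut
    using invertible_ex1[OF pos_semidef_plus_pos_def_invertible[OF A M \<open>c > 0\<close>]] by blast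
  have T: "\<exists>!x. T *v x = y" for y
    by (rule invertible_ex1[OF T_invertible])
  have S_unique: "u = v" if "?S u" "?S v" for u v
    using constrained_system_unique \<open>c > 0\<close> that by blast
  \<comment> \<open>Both directions come from one solution of the formula: it solves the constrained
    system, so it equals \<open>u\<close>, and every other solution of the formula does too.\<close>
  have "?E ug ut v \<longleftrightarrow> v = u"
    if "constrained_system A M B c F G u p" "T *v ug = (B ** U) *v G" "T *v ut = F"
    for u p ug ut v
    using ES E S_unique that by metis
  moreover have "\<exists>!u. ?S u"
    using ES E S_unique T by metis
  ultimately show ?thesis using C0_eq_gen_eigenspace T by blast
qed

end
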